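(* Let $\mathbf{S}$ be a completely simple semigroup and let $\rho,\sigma$ be congruences on $\mathbf{S}$. Then $[\rho,\sigma]=[\sigma,\rho]$.
   Context: A completely simple semigroup is a simple semigroup (no proper ideals) containing a primitive idempotent, i.e. an element $e$ such that $x=e$ is the unique solution of $ex=xe=x=x^2$. $\mathbb{N}=\{1,2,\dots\}$. For an algebra $\mathbf{A}$ and congruences $\alpha,\beta,\delta$ of $\mathbf{A}$, $C(\alpha,\beta;\delta)$ means: for all $n\in\mathbb{N}$, all $(n+1)$-ary term functions $t$ of $\mathbf{A}$, all $a,b\in A$ and $\mathbf{c},\mathbf{d}\in A^n$ with $a\,\alpha\,b$ and $c_i\,\beta\,d_i$ for every $i$, $t(a,\mathbf{c})\,\delta\,t(a,\mathbf{d})$ implies $t(b,\mathbf{c})\,\delta\,t(b,\mathbf{d})$. The commutator $[\alpha,\beta]$ is the least congruence $\delta$ with $C(\alpha,\beta;\delta)$. Semigroups are algebras with one binary operation. *)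

theory Defs
  imports Main
begin

text \<open>
  A semigroup is a type of class \<open>semigroup_mult\<close>, viewed as an algebra whose only basic operation
  is \<open>(*)\<close>. Binary relations, in particular congruences, are sets of pairs ordered by inclusion.
\<close>

definition congruence :: "('a::times \<times> 'a) set \<Rightarrow> bool" where
  "congruence r \<longleftrightarrow> equiv UNIV r \<and>
     (\<forall>a b c d. (a, b) \<in> r \<longrightarrow> (c, d) \<in> r \<longrightarrow> (a * c, b * d) \<in> r)"

text \<open>Ideals are two-sided and nonempty, since otherwise no semigroup would be simple.\<close>

definition semigroup_ideal :: "'a::times set \<Rightarrow> bool" where
  "semigroup_ideal I \<longleftrightarrow> I \<noteq> {} \<and> (\<forall>s. \<forall>x\<in>I. s * x \<in> I \<and> x * s \<in> I)"

definition simple_semigroup :: "'a::semigroup_mult itself \<Rightarrow> bool" where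
  "simple_semigroup _ \<longleftrightarrow> (\<forall>I::'a set. semigroup_ideal I \<longrightarrow> I = UNIV)"

definition primitive_idempotent :: "'a::times \<Rightarrow> bool" where
  "primitive_idempotent e \<longleftrightarrow> (\<forall>x. (e * x = x \<and> x * e = x \<and> x * x = x) \<longleftrightarrow> x = e)"

definition completely_simple :: "'a::semigroup_mult itself \<Rightarrow> bool" where
  "completely_simple T \<longleftrightarrow> simple_semigroup T \<and> (\<exists>e::'a. primitive_idempotent e)"

datatype mult_term = Var nat | Mult mult_term mult_term

fun vars :: "mult_term \<Rightarrow> nat set" where
  "vars (Var i) = {i}"
| "vars (Mult s t) = vars s \<union> vars t"

fun eval_term :: "mult_term \<Rightarrow> 'a::times list \<Rightarrow> 'a" where
  "eval_term (Var i) xs = xs ! i"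
| "eval_term (Mult s t) xs = eval_term s xs * eval_term t xs"

text \<open>
  The \<open>k\<close>-ary term functions; a \<open>k\<close>-tuple is a list of length \<open>k\<close>, and only the values on such
  lists are meaningful.
\<close>

definition term_functions :: "nat \<Rightarrow> ('a::times list \<Rightarrow> 'a) set" where
  "term_functions k = {eval_term t | t. vars t \<subseteq> {..<k}}"

text \<open>
  In the term condition \<open>C(\<alpha>, \<beta>; \<delta>)\<close> the head of the argument list varies along \<open>\<alpha>\<close> and
  the tail along \<open>\<beta>\<close>.
\<close>

definition centralizes ::
    "('a::times \<times> 'a) set \<Rightarrow> ('a \<times> 'a) set \<Rightarrow> ('a \<times> 'a) set \<Rightarrow> bool" where
  "centralizes \<alpha> \<beta> \<delta> \<longleftrightarrow>
     (\<forall>n\<ge>1. \<forall>t\<in>term_functions (n + 1). \<forall>a b cs ds.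
        (a, b) \<in> \<alpha> \<longrightarrow> length cs = n \<longrightarrow> length ds = n \<longrightarrow>
        (\<forall>i<n. (cs ! i, ds ! i) \<in> \<beta>) \<longrightarrow>
        (t (a # cs), t (a # ds)) \<in> \<delta> \<longrightarrow> (t (b # cs), t (b # ds)) \<in> \<delta>)"

definition commutator ::
    "('a::times \<times> 'a) set \<Rightarrow> ('a \<times> 'a) set \<Rightarrow> ('a \<times> 'a) set" where
  "commutator \<alpha> \<beta> = (LEAST \<delta>. congruence \<delta> \<and> centralizes \<alpha> \<beta> \<delta>)"

text \<open>The least such congruence always exists, namely the intersection of all of them.\<close>

lemma congruence_Inter:
  assumes "\<And>r. r \<in> R \<Longrightarrow> congruence r"
  shows "congruence (\<Inter>R)"
proof -
  have e: "equiv UNIV r" if "r \<in> R" for r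
    using assms[OF that] by (simp add: congruence_def)
  have "equiv UNIV (\<Inter>R)"
  proof (rule equivI)
    show "refl (\<Inter>R)"
      using e by (auto simp: equiv_def refl_on_def)
    show "sym (\<Inter>R)"
      using e by (meson InterE InterI equiv_def symD symI)
    show "trans (\<Inter>R)"
      using e by (meson InterE InterI equiv_def transD transI)
  qed simp
  then show ?thesis
    using assms by (auto simp: congruence_def)
qed

lemma centralizes_Inter:
  assumes "\<And>\<delta>. \<delta> \<in> R \<Longrightarrow> centralizes \<alpha> \<beta> \<delta>"
  shows "centralizes \<alpha> \<beta> (\<Inter>R)"
  unfolding centralizes_def
proof (intro allI impI ballI InterI)
  fix n t a b cs ds \<delta>
  assume *: "1 \<le> n" "t \<in> term_functions (n + 1)" "(a, b) \<in> \<alpha>" "length cs = n" "length ds = n"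
    "\<forall>i<n. (cs ! i, ds ! i) \<in> \<beta>" "(t (a # cs), t (a # ds)) \<in> \<Inter>R" "\<delta> \<in> R"
  then show "(t (b # cs), t (b # ds)) \<in> \<delta>"
    using assms[OF \<open>\<delta> \<in> R\<close>] unfolding centralizes_def by blast
qed

lemma commutator_eq_Inter:
  "commutator \<alpha> \<beta> = \<Inter>{\<delta>. congruence \<delta> \<and> centralizes \<alpha> \<beta> \<delta>}"
  unfolding commutator_def
  by (rule Least_equality) (auto intro!: congruence_Inter centralizes_Inter)

lemma commutator_least:
  shows "congruence (commutator \<alpha> \<beta>)"
    and "centralizes \<alpha> \<beta> (commutator \<alpha> \<beta>)"
    and "congruence \<delta> \<Longrightarrow> centralizes \<alpha> \<beta> \<delta> \<Longrightarrow> commutator \<alpha> \<beta> \<subseteq> \<delta>"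
  unfolding commutator_eq_Inter by (auto intro!: congruence_Inter centralizes_Inter)

end

theory Submission
  imports Defs
begin

text \<open>
  In a completely simple semigroup every element lies in a subgroup, and all products that begin
  with \<open>x\<close> lie in the \<open>R\<close>-class of \<open>x\<close>, all products that end with \<open>x\<close> in its \<open>L\<close>-class. Hence
  sandwiched elements \<open>b * c * b'\<close> and \<open>b * d * b'\<close> share a maximal subgroup, and one can compute
  with them as in a group.

  Replacing the occurrences of the distinguished variable of a term one at a time, and cancelling
  missing outer factors, turns \<open>C(\<alpha>, \<beta>; \<delta>)\<close> into a condition on products of three elements
  (lemma \<open>centralizes_iff_sandwich_condition\<close>): if \<open>a \<alpha> b\<close>, \<open>u \<beta> w\<close> and \<open>v \<beta> z\<close>, then
  \<open>u a v \<delta> w a z\<close> implies \<open>u b v \<delta> w b z\<close>.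

  That condition is symmetric in \<open>\<alpha>\<close> and \<open>\<beta>\<close> (lemma \<open>sandwich_condition_commute\<close>), for the reason
  that makes the commutator symmetric in groups. Suppose that \<open>c \<beta> d\<close>, \<open>a \<alpha> b\<close>, \<open>a' \<alpha> b'\<close> and
  \<open>a c a' \<delta> b c b'\<close>. The polynomial \<open>f(x, x', y) = x y x' (b y b')\<inverse> b c b'\<close> satisfies
  \<open>f(b, b', c) = b c b' = f(b, b', d)\<close>. The condition for \<open>(\<alpha>, \<beta>)\<close>, used once for \<open>x\<close> and once
  for \<open>x'\<close>, gives \<open>f(a, a', c) \<delta> f(a, a', d)\<close>, and cancellation leaves \<open>a d a' \<delta> b d b'\<close>. The
  inverse is not a semigroup term, but this does not matter: the condition refers to arbitrary
  \<open>\<beta>\<close>-related elements, and congruences respect inverses in subgroups.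
  So \<open>C(\<rho>, \<sigma>; \<delta>)\<close> and \<open>C(\<sigma>, \<rho>; \<delta>)\<close> hold for the same congruences \<open>\<delta>\<close>.
\<close>

section \<open>Congruences\<close>

lemma congruenceD:
  assumes "congruence r"
  shows congruence_refl: "(x, x) \<in> r"
    and congruence_sym: "(x, y) \<in> r \<Longrightarrow> (y, x) \<in> r"
    and congruence_trans: "(x, y) \<in> r \<Longrightarrow> (y, z) \<in> r \<Longrightarrow> (x, z) \<in> r"
    and congruence_mult: "(x, y) \<in> r \<Longrightarrow> (x', y') \<in> r \<Longrightarrow> (x * x', y * y') \<in> r"
proof -
  have "equiv UNIV r"
    using assms by (simp add: congruence_def)
  then show "(x, x) \<in> r"
    and "(x, y) \<in> r \<Longrightarrow> (y, x) \<in> r"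
    and "(x, y) \<in> r \<Longrightarrow> (y, z) \<in> r \<Longrightarrow> (x, z) \<in> r"
    by (auto simp: equiv_def refl_on_def dest: symD transD)
  show "(x, y) \<in> r \<Longrightarrow> (x', y') \<in> r \<Longrightarrow> (x * x', y * y') \<in> r"
    using assms by (auto simp: congruence_def)
qed

section \<open>Completely simple semigroups\<close>

lemma simple_semigroup_factorization:
  fixes a b :: "'a::semigroup_mult"
  assumes "simple_semigroup TYPE('a)"
  shows "\<exists>x y. b = x * a * y"
proof -
  have "semigroup_ideal {x * a * y | x y. True}"
    unfolding semigroup_ideal_def
    by (auto simp: mult.assoc) (metis mult.assoc)+
  then have "{x * a * y | x y. True} = UNIV"
    using assms unfolding simple_semigroup_def by blast
  then show ?thesis by blast
qed

text \<open>
  The local monoid \<open>e S e\<close> is a group: if \<open>x * h * y = e\<close> there, then \<open>h * y * x\<close> and \<open>y * x * h\<close>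
  are idempotents below \<open>e\<close>, so both equal \<open>e\<close> by primitivity.
\<close>

lemma primitive_idempotent_local_group:
  fixes e :: "'a::semigroup_mult"
  assumes simple: "simple_semigroup TYPE('a)" and e: "primitive_idempotent e"
    and h: "e * h = h" "h * e = h"
  shows "\<exists>g. h * g = e \<and> g * h = e \<and> e * g = g \<and> g * e = g"
proof -
  have ee: "e * e = e"
    using e unfolding primitive_idempotent_def by blast
  have ee': "e * (e * z) = e * z" for z
    by (metis ee mult.assoc)
  have prim: "f = e" if "e * f = f" "f * e = f" "f * f = f" for f
    using e that unfolding primitive_idempotent_def by blast
  obtain x0 y0 where xy0: "e = x0 * h * y0"
    using simple_semigroup_factorization[OF simple] by blast
  define x y where "x = e * x0 * e" and "y = e * y0 * e"
  have x: "e * x = x" "x * e = x" and y: "e * y = y" "y * e = y"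
    by (simp_all add: x_def y_def mult.assoc ee ee')
  have xhy: "x * h * y = e"
  proof -
    have "x * h * y = e * (x0 * ((e * h) * e) * y0) * e"
      by (simp add: x_def y_def mult.assoc)
    also have "\<dots> = e"
      by (simp add: h xy0[symmetric] ee)
    finally show ?thesis .
  qed
  have "h * y * x = e"
  proof (rule prim)
    show "e * (h * y * x) = h * y * x" by (metis h(1) mult.assoc)
    show "h * y * x * e = h * y * x" by (metis x(2) mult.assoc)
    have "h * y * x * (h * y * x) = h * y * (x * h * y) * x" by (simp add: mult.assoc)
    then show "h * y * x * (h * y * x) = h * y * x" by (metis xhy y(2) mult.assoc)
  qed
  moreover have "y * x * h = e"
  proof (rule prim)
    show "e * (y * x * h) = y * x * h" by (metis y(1) mult.assoc)
    show "y * x * h * e = y * x * h" by (metis h(2) mult.assoc)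
    have "y * x * h * (y * x * h) = y * (x * h * y) * x * h" by (simp add: mult.assoc)
    then show "y * x * h * (y * x * h) = y * x * h" by (metis xhy y(2))
  qed
  ultimately show ?thesis
    by (intro exI[of _ "y * x"]) (metis mult.assoc x y)
qed

text \<open>
  Every \<open>x\<close> is \<open>p * q\<close> with \<open>p\<close> in \<open>S e\<close> and \<open>q\<close> in \<open>e S\<close>; the factor \<open>y\<close> is then undone by
  inverting \<open>q * y * p\<close> in the group \<open>e S e\<close>. In terms of Green's relations, \<open>x * y\<close> is
  \<open>R\<close>-related to \<open>x\<close>, and \<open>y * x\<close> is \<open>L\<close>-related to \<open>x\<close>.
\<close>

lemma completely_simple_cancel_factor:
  fixes x y :: "'a::semigroup_mult"
  assumes "completely_simple TYPE('a)"
  shows completely_simple_cancel_right: "\<exists>w. x * y * w = x"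
    and completely_simple_cancel_left: "\<exists>w. w * y * x = x"
proof -
  obtain e :: 'a where simple: "simple_semigroup TYPE('a)" and e: "primitive_idempotent e"
    using assms unfolding completely_simple_def by blast
  have ee: "e * e = e"
    using e unfolding primitive_idempotent_def by blast
  obtain s t where "x = s * e * t"
    using simple_semigroup_factorization[OF simple] by blast
  then obtain p q where x: "x = p * q" and p: "p * e = p" and q: "e * q = q"
    by (metis ee mult.assoc)
  have "e * (q * y * p) = q * y * p" "q * y * p * e = q * y * p"
    by (metis p q mult.assoc)+
  then obtain g where g: "q * y * p * g = e" "g * (q * y * p) = e"
    using primitive_idempotent_local_group[OF simple e] by blast
  have "x * y * (p * g * q) = p * (q * y * p * g) * q"
    by (simp add: x mult.assoc)
  then show "\<exists>w. x * y * w = x"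
    by (metis g(1) p x)
  have "p * g * q * y * x = p * (g * (q * y * p)) * q"
    by (simp add: x mult.assoc)
  then show "\<exists>w. w * y * x = x"
    by (metis g(2) p x)
qed

definition group_inverse :: "'a::semigroup_mult \<Rightarrow> 'a \<Rightarrow> bool" where
  "group_inverse x y \<longleftrightarrow> x * y * x = x \<and> y * x * y = y \<and> x * y = y * x"

text \<open>
  If \<open>x * x * w = x = v * x * x\<close>, then \<open>x * w = v * x\<close> is the identity of the subgroup that
  contains \<open>x\<close>, and \<open>v * x * w\<close> is the inverse there.
\<close>

lemma completely_simple_group_inverse_exists:
  fixes x :: "'a::semigroup_mult"
  assumes "completely_simple TYPE('a)"
  shows "\<exists>y. group_inverse x y"
proof -
  obtain v w where w: "x * x * w = x" and v: "v * x * x = x"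
    using completely_simple_cancel_factor[OF assms] by blast
  have id: "x * w = v * x"
    by (metis v w mult.assoc)
  have xvx: "x * v * x = x" and xwx: "x * w * x = x"
    by (metis id v w mult.assoc)+
  have "x * (v * x * w) = x * w" "v * x * w * x = v * x"
    by (metis xvx xwx mult.assoc)+
  then have "group_inverse x (v * x * w)"
    unfolding group_inverse_def by (metis id xwx xvx mult.assoc)
  then show ?thesis ..
qed

text \<open>
  Modulo the congruence, the two inverses belong to the same element, where the usual uniqueness
  argument applies.
\<close>

lemma congruence_group_inverse:
  assumes r: "congruence r" and xy: "(x, y) \<in> r"
    and x: "group_inverse x x'" and y: "group_inverse y y'"
  shows "(x', y') \<in> r"
proof -
  note refl = congruence_refl[OF r] and sym = congruence_sym[OF r]
    and trans = congruence_trans[OF r] and mult = congruence_mult[OF r]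
  have yx: "(y, x) \<in> r" by (rule sym[OF xy])
  have ids: "(x' * x, y' * y) \<in> r"
  proof -
    have "(x' * x, x' * y) \<in> r" by (intro mult refl xy)
    also have "x' * y = x' * y * (y' * y)"
      using y by (metis group_inverse_def mult.assoc)
    finally have "(x' * x, x' * y * (y' * y)) \<in> r" .
    moreover have "(x' * y * (y' * y), x' * x * (y' * x)) \<in> r"
      by (intro mult refl yx)
    moreover have "(x' * x * (y' * x), x' * x * (y' * y)) \<in> r"
      by (intro mult refl xy)
    moreover have "x' * x * (y' * y) = x * x' * (y * y')"
      using x y by (simp add: group_inverse_def)
    moreover have "(x * x' * (y * y'), x * x' * (x * y')) \<in> r"
      by (intro mult refl yx)
    moreover have "x * x' * (x * y') = x * y'"
      using x by (metis group_inverse_def mult.assoc)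
    moreover have "(x * y', y * y') \<in> r"
      by (intro mult refl xy)
    moreover have "y * y' = y' * y"
      using y by (simp add: group_inverse_def)
    ultimately show ?thesis
      by (metis trans)
  qed
  have "x' = x' * x * x'" "y' * y * y' = y'"
    using x y by (auto simp: group_inverse_def)
  moreover have "(x' * x * x', y' * y * x') \<in> r"
    by (intro mult ids refl)
  moreover have "(y' * y * x', y' * x * x') \<in> r"
    by (intro mult refl yx)
  moreover have "y' * x * x' = y' * (x' * x)"
    using x by (simp add: group_inverse_def mult.assoc)
  moreover have "(y' * (x' * x), y' * (y' * y)) \<in> r"
    by (intro mult ids refl)
  moreover have "y' * (y' * y) = y'"
    using y by (metis group_inverse_def mult.assoc)
  ultimately show ?thesis
    by (metis trans)
qed

section \<open>The term condition as a condition on triple products\<close>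

definition sandwich_condition ::
    "('a::times \<times> 'a) set \<Rightarrow> ('a \<times> 'a) set \<Rightarrow> ('a \<times> 'a) set \<Rightarrow> bool" where
  "sandwich_condition \<alpha> \<beta> \<delta> \<longleftrightarrow>
     (\<forall>a b u w v z. (a, b) \<in> \<alpha> \<longrightarrow> (u, w) \<in> \<beta> \<longrightarrow> (v, z) \<in> \<beta> \<longrightarrow>
        (u * a * v, w * a * z) \<in> \<delta> \<longrightarrow> (u * b * v, w * b * z) \<in> \<delta>)"

text \<open>
  A missing outer factor is supplied on the left of both sides: if \<open>w\<close> is chosen with
  \<open>w * b * b = b\<close>, then the factor \<open>w * b\<close> disappears again in front of \<open>b\<close>.
\<close>

lemma sandwich_condition_right_factor:
  fixes a b :: "'a::semigroup_mult"
  assumes cs: "completely_simple TYPE('a)" and \<beta>: "congruence \<beta>" and \<delta>: "congruence \<delta>"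
    and sw: "sandwich_condition \<alpha> \<beta> \<delta>"
    and ab: "(a, b) \<in> \<alpha>" and vz: "(v, z) \<in> \<beta>" and eq: "(a * v, a * z) \<in> \<delta>"
  shows "(b * v, b * z) \<in> \<delta>"
proof -
  obtain w where w: "w * b * b = b"
    using completely_simple_cancel_left[OF cs] by blast
  have "(w * b * (a * v), w * b * (a * z)) \<in> \<delta>"
    by (intro congruence_mult[OF \<delta>] congruence_refl[OF \<delta>] eq)
  then have "(w * b * a * v, w * b * a * z) \<in> \<delta>"
    by (simp add: mult.assoc)
  then have "(w * b * b * v, w * b * b * z) \<in> \<delta>"
    using sw ab vz congruence_refl[OF \<beta>] unfolding sandwich_condition_def by blast
  then show ?thesis
    by (simp add: w)
qed

lemma sandwich_condition_left_factor:
  fixes a b :: "'a::semigroup_mult"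
  assumes cs: "completely_simple TYPE('a)" and \<beta>: "congruence \<beta>" and \<delta>: "congruence \<delta>"
    and sw: "sandwich_condition \<alpha> \<beta> \<delta>"
    and ab: "(a, b) \<in> \<alpha>" and uw: "(u, w) \<in> \<beta>" and eq: "(u * a, w * a) \<in> \<delta>"
  shows "(u * b, w * b) \<in> \<delta>"
proof -
  obtain k where k: "b * b * k = b"
    using completely_simple_cancel_right[OF cs] by blast
  have "(u * a * (b * k), w * a * (b * k)) \<in> \<delta>"
    by (intro congruence_mult[OF \<delta>] congruence_refl[OF \<delta>] eq)
  then have "(u * b * (b * k), w * b * (b * k)) \<in> \<delta>"
    using sw ab uw congruence_refl[OF \<beta>] unfolding sandwich_condition_def by blast
  moreover have "s * b * (b * k) = s * b" for s
    by (metis k mult.assoc)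
  ultimately show ?thesis
    by simp
qed

text \<open>
  The surroundings of one occurrence of the distinguished variable, evaluated at two
  \<open>\<beta>\<close>-related tuples. Either outer factor may be missing.
\<close>

inductive related_translations ::
    "('a::times \<times> 'a) set \<Rightarrow> ('a \<Rightarrow> 'a) \<Rightarrow> ('a \<Rightarrow> 'a) \<Rightarrow> bool"
  for \<beta> where
  none: "related_translations \<beta> (\<lambda>x. x) (\<lambda>x. x)"
| left: "(u, w) \<in> \<beta> \<Longrightarrow> related_translations \<beta> (\<lambda>x. u * x) (\<lambda>x. w * x)"
| right: "(v, z) \<in> \<beta> \<Longrightarrow> related_translations \<beta> (\<lambda>x. x * v) (\<lambda>x. x * z)"
| both: "(u, w) \<in> \<beta> \<Longrightarrow> (v, z) \<in> \<beta> \<Longrightarrow>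
    related_translations \<beta> (\<lambda>x. u * x * v) (\<lambda>x. w * x * z)"

lemma related_translations_mult_left:
  fixes s t :: "'a::semigroup_mult"
  assumes "congruence \<beta>" "related_translations \<beta> F G" "(s, t) \<in> \<beta>"
  shows "related_translations \<beta> (\<lambda>x. F (s * x)) (\<lambda>x. G (t * x))"
  using assms(2)
proof cases
  case none
  then show ?thesis
    using related_translations.left[OF assms(3)] by simp
next
  case (left u w)
  then show ?thesis
    using related_translations.left[OF congruence_mult[OF assms(1) left(3) assms(3)]]
    by (simp add: mult.assoc)
next
  case (right v z)
  then show ?thesis
    using related_translations.both[OF assms(3) right(3)] by simp
next
  case (both u w v z)
  then show ?thesis
    using related_translations.both[OF congruence_mult[OF assms(1) both(3) assms(3)] both(4)]
    by (simp add: mult.assoc)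
qed

lemma related_translations_mult_right:
  fixes s t :: "'a::semigroup_mult"
  assumes "congruence \<beta>" "related_translations \<beta> F G" "(s, t) \<in> \<beta>"
  shows "related_translations \<beta> (\<lambda>x. F (x * s)) (\<lambda>x. G (x * t))"
  using assms(2)
proof cases
  case none
  then show ?thesis
    using related_translations.right[OF assms(3)] by simp
next
  case (left u w)
  then show ?thesis
    using related_translations.both[OF left(3) assms(3)] by (simp add: mult.assoc)
next
  case (right v z)
  then show ?thesis
    using related_translations.right[OF congruence_mult[OF assms(1) assms(3) right(3)]]
    by (simp add: mult.assoc)
next
  case (both u w v z)
  then show ?thesis
    using related_translations.both[OF both(3) congruence_mult[OF assms(1) assms(3) both(4)]]
    by (simp add: mult.assoc)
qed

lemma sandwich_condition_translations:
  fixes a b :: "'a::semigroup_mult"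
  assumes "completely_simple TYPE('a)" "congruence \<beta>" "congruence \<delta>"
    and "sandwich_condition \<alpha> \<beta> \<delta>" "(a, b) \<in> \<alpha>"
    and "related_translations \<beta> F G" "(F a, G a) \<in> \<delta>"
  shows "(F b, G b) \<in> \<delta>"
  using assms(6)
proof cases
  case none
  then show ?thesis
    using congruence_refl[OF assms(3)] by simp
next
  case (left u w)
  then show ?thesis
    using sandwich_condition_left_factor[OF assms(1-5) left(3)] assms(7) by simp
next
  case (right v z)
  then show ?thesis
    using sandwich_condition_right_factor[OF assms(1-5) right(3)] assms(7) by simp
next
  case (both u w v z)
  then show ?thesis
    using assms(4,5,7) unfolding sandwich_condition_def by auto
qed

lemma eval_term_congruence:
  assumes "congruence \<beta>" and "\<And>i. i \<in> vars t \<Longrightarrow> (xs ! i, ys ! i) \<in> \<beta>"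
  shows "(eval_term t xs, eval_term t ys) \<in> \<beta>"
  using assms(2) by (induction t) (auto intro: congruence_mult[OF assms(1)])

text \<open>
  The translations make the induction possible: in a product, each factor is treated while the
  other one, which evaluates to \<open>\<beta>\<close>-related elements, belongs to its surroundings. The left factor
  is changed first, so that it is already evaluated at \<open>b\<close> when the right factor is changed.
\<close>

lemma sandwich_condition_eval_term:
  fixes a b :: "'a::semigroup_mult"
  assumes "completely_simple TYPE('a)" and \<beta>: "congruence \<beta>" and "congruence \<delta>"
    and "sandwich_condition \<alpha> \<beta> \<delta>" and "(a, b) \<in> \<alpha>"
    and len: "length cs = n" "length ds = n" and csds: "\<forall>i<n. (cs ! i, ds ! i) \<in> \<beta>"
    and "vars t \<subseteq> {..<n + 1}"
    and "related_translations \<beta> F G"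
    and "(F (eval_term t (a # cs)), G (eval_term t (a # ds))) \<in> \<delta>"
  shows "(F (eval_term t (b # cs)), G (eval_term t (b # ds))) \<in> \<delta>"
  using assms(9-11)
proof (induction t arbitrary: F G)
  case (Var i)
  show ?case
  proof (cases i)
    case 0
    then show ?thesis
      using Var sandwich_condition_translations[OF assms(1-5)] by simp
  next
    case (Suc j)
    then show ?thesis
      using Var by simp
  qed
next
  case (Mult s t)
  have related: "(eval_term r (x # cs), eval_term r (x # ds)) \<in> \<beta>"
    if "vars r \<subseteq> {..<n + 1}" for r x
    using that csds congruence_refl[OF \<beta>]
    by (intro eval_term_congruence[OF \<beta>]) (auto simp: nth_Cons split: nat.split)
  have vs: "vars s \<subseteq> {..<n + 1}" and vt: "vars t \<subseteq> {..<n + 1}"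
    using Mult.prems(1) by auto
  have "(F (eval_term s (b # cs) * eval_term t (a # cs)),
         G (eval_term s (b # ds) * eval_term t (a # ds))) \<in> \<delta>"
    using Mult.prems(3)
    by (intro Mult.IH(1)[OF vs related_translations_mult_right[OF \<beta> Mult.prems(2)
          related[OF vt]]]) simp
  then have "(F (eval_term s (b # cs) * eval_term t (b # cs)),
         G (eval_term s (b # ds) * eval_term t (b # ds))) \<in> \<delta>"
    by (intro Mult.IH(2)[OF vt related_translations_mult_left[OF \<beta> Mult.prems(2)
          related[OF vs]]])
  then show ?case
    by simp
qed

lemma centralizes_imp_sandwich_condition:
  assumes "centralizes \<alpha> \<beta> \<delta>"
  shows "sandwich_condition \<alpha> \<beta> \<delta>"
  unfolding sandwich_condition_def
proof (intro allI impI)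
  fix a b u w v z
  assume ab: "(a, b) \<in> \<alpha>" and uw: "(u, w) \<in> \<beta>" and vz: "(v, z) \<in> \<beta>"
    and eq: "(u * a * v, w * a * z) \<in> \<delta>"
  let ?t = "Mult (Mult (Var 1) (Var 0)) (Var 2)"
  have "eval_term ?t \<in> term_functions (2 + 1)"
    unfolding term_functions_def by fastforce
  moreover have "\<forall>i<2. ([u, v] ! i, [w, z] ! i) \<in> \<beta>"
    using uw vz by (simp add: less_2_cases_iff)
  moreover have "(eval_term ?t (a # [u, v]), eval_term ?t (a # [w, z])) \<in> \<delta>"
    using eq by (simp add: numeral_2_eq_2)
  ultimately have "(eval_term ?t (b # [u, v]), eval_term ?t (b # [w, z])) \<in> \<delta>"
    using assms[unfolded centralizes_def, rule_format, of 2 "eval_term ?t" a b "[u, v]" "[w, z]"]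
      ab by simp
  then show "(u * b * v, w * b * z) \<in> \<delta>"
    by (simp add: numeral_2_eq_2)
qed

lemma centralizes_iff_sandwich_condition:
  fixes \<alpha> \<beta> \<delta> :: "('a::semigroup_mult \<times> 'a) set"
  assumes "completely_simple TYPE('a)" and "congruence \<beta>" and "congruence \<delta>"
  shows "centralizes \<alpha> \<beta> \<delta> \<longleftrightarrow> sandwich_condition \<alpha> \<beta> \<delta>"
proof
  assume "sandwich_condition \<alpha> \<beta> \<delta>"
  then show "centralizes \<alpha> \<beta> \<delta>"
    unfolding centralizes_def term_functions_def
    using sandwich_condition_eval_term[OF assms _ _ _ _ _ _ related_translations.none]
    by blast
qed (rule centralizes_imp_sandwich_condition)

section \<open>Symmetry\<close>

text \<open>
  Write \<open>p = b * c * b'\<close> and \<open>q = b * d * b'\<close>. The polynomial of the introduction is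
  \<open>f(x, x', y) = x * y * x' * (b * y * b')\<inverse> * p\<close>; then \<open>f(a, a', c)\<close> is \<open>p\<close> modulo \<open>\<delta>\<close>, and
  multiplying \<open>f(a, a', d)\<close> by \<open>p\<inverse> * q\<close> recovers \<open>a * d * a'\<close> modulo \<open>\<delta>\<close>.
\<close>

lemma sandwich_condition_commute:
  fixes \<alpha> \<beta> \<delta> :: "('a::semigroup_mult \<times> 'a) set"
  assumes cs: "completely_simple TYPE('a)"
    and \<alpha>: "congruence \<alpha>" and \<beta>: "congruence \<beta>" and \<delta>: "congruence \<delta>"
    and sw: "sandwich_condition \<alpha> \<beta> \<delta>"
  shows "sandwich_condition \<beta> \<alpha> \<delta>"
  unfolding sandwich_condition_def
proof (intro allI impI)
  fix c d a b a' b'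
  assume cd: "(c, d) \<in> \<beta>" and ab: "(a, b) \<in> \<alpha>" and ab': "(a', b') \<in> \<alpha>"
    and eq: "(a * c * a', b * c * b') \<in> \<delta>"
  note refl = congruence_refl[OF \<delta>] and sym = congruence_sym[OF \<delta>]
    and trans = congruence_trans[OF \<delta>] and mult = congruence_mult[OF \<delta>]
  note refl\<^sub>\<beta> = congruence_refl[OF \<beta>] and mult\<^sub>\<beta> = congruence_mult[OF \<beta>]
  define p where "p = b * c * b'"
  define q where "q = b * d * b'"
  obtain p' q' where p': "group_inverse p p'" and q': "group_inverse q q'"
    using completely_simple_group_inverse_exists[OF cs] by blast
  have pq: "(p, q) \<in> \<beta>"
    unfolding p_def q_def by (intro mult\<^sub>\<beta> refl\<^sub>\<beta> cd)
  have pq': "(p', q') \<in> \<beta>"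
    by (rule congruence_group_inverse[OF \<beta> pq p' q'])

  \<comment> \<open>\<open>p\<close> and \<open>q\<close> lie in the same maximal subgroup\<close>
  obtain k where k: "b * (d * b') * k = b"
    using completely_simple_cancel_right[OF cs] by blast
  obtain l where l: "b * (c * b') * l = b"
    using completely_simple_cancel_right[OF cs] by blast
  obtain m where m: "m * (b * d) * b' = b'"
    using completely_simple_cancel_left[OF cs] by blast
  have "p = q * (k * (c * b'))"
    unfolding p_def q_def by (metis k mult.assoc)
  then have qp: "q * q' * p = p"
    using q' by (metis group_inverse_def mult.assoc)
  have "q = p * (l * (d * b'))"
    unfolding p_def q_def by (metis l mult.assoc)
  then have pq_id: "p * p' * q = q"
    using p' by (metis group_inverse_def mult.assoc)
  have "p = b * c * m * q"
    unfolding p_def q_def by (metis m mult.assoc)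
  then have pq_id': "p * q' * q = p"
    using q' by (metis group_inverse_def mult.assoc)

  \<comment> \<open>\<open>f(b, b', c) = p = f(b, b', d)\<close>; first \<open>b\<close> is replaced by \<open>a\<close>, then \<open>b'\<close> by \<open>a'\<close>\<close>
  have "b * (c * b' * (p' * p)) = p * p' * p" "b * (d * b' * (q' * p)) = q * q' * p"
    by (simp_all add: p_def q_def mult.assoc)
  then have "(b * (c * b' * (p' * p)), b * (d * b' * (q' * p))) \<in> \<delta>"
    using p' qp refl by (metis group_inverse_def)
  then have "(a * (c * b' * (p' * p)), a * (d * b' * (q' * p))) \<in> \<delta>"
    by (rule sandwich_condition_right_factor[OF cs \<beta> \<delta> sw congruence_sym[OF \<alpha> ab], rotated])
      (intro mult\<^sub>\<beta> refl\<^sub>\<beta> cd pq')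
  then have "((a * c) * b' * (p' * p), (a * d) * b' * (q' * p)) \<in> \<delta>"
    by (simp add: mult.assoc)
  moreover have "(a * c, a * d) \<in> \<beta>" "(p' * p, q' * p) \<in> \<beta>"
    by (intro mult\<^sub>\<beta> refl\<^sub>\<beta> cd pq')+
  ultimately have f: "((a * c) * a' * (p' * p), (a * d) * a' * (q' * p)) \<in> \<delta>"
    using sw congruence_sym[OF \<alpha> ab'] unfolding sandwich_condition_def by blast

  \<comment> \<open>cancelling \<open>p\<close> on the right\<close>
  have "((a * c) * a' * (p' * p), p * (p' * p)) \<in> \<delta>"
    using eq unfolding p_def[symmetric] by (intro mult refl)
  moreover have "p * (p' * p) = p"
    using p' by (metis group_inverse_def mult.assoc)
  ultimately have "(p, (a * d) * a' * (q' * p)) \<in> \<delta>"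
    using f by (metis sym trans)
  then have "(p * (p' * q), (a * d) * a' * (q' * p) * (p' * q)) \<in> \<delta>"
    by (intro mult refl)
  moreover have "p * (p' * q) = q"
    using pq_id by (simp add: mult.assoc)
  moreover have "(a * d) * a' * (q' * p) * (p' * q) = a * d * (a' * (q' * q))"
    using pq_id by (simp add: mult.assoc)
  ultimately have q_eq: "(q, a * d * (a' * (q' * q))) \<in> \<delta>"
    by simp

  \<comment> \<open>modulo \<open>\<delta>\<close>, \<open>a'\<close> is a left multiple of \<open>p\<close>, for which \<open>q' * q\<close> is a right identity\<close>
  obtain s where s: "s * (a * c) * a' = a'"
    using completely_simple_cancel_left[OF cs] by blast
  have a': "(a', s * p) \<in> \<delta>"
  proof -
    have "(s * (a * c * a'), s * p) \<in> \<delta>"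
      using eq unfolding p_def[symmetric] by (intro mult refl)
    then show ?thesis
      using s by (simp add: mult.assoc)
  qed
  have "(a' * (q' * q), s * p * (q' * q)) \<in> \<delta>"
    by (intro mult refl a')
  moreover have "s * p * (q' * q) = s * p"
    using pq_id' by (simp add: mult.assoc)
  ultimately have "(a' * (q' * q), a') \<in> \<delta>"
    using a' by (metis sym trans)
  then have "(a * d * (a' * (q' * q)), a * d * a') \<in> \<delta>"
    by (intro mult refl)
  then show "(a * d * a', b * d * b') \<in> \<delta>"
    using q_eq unfolding q_def[symmetric] by (metis sym trans)
qed

theorem proposition5p4:
  fixes \<rho> \<sigma> :: "('a::semigroup_mult \<times> 'a) set"
  assumes "completely_simple TYPE('a)"
    and "congruence \<rho>" and "congruence \<sigma>"
  shows "commutator \<rho> \<sigma> = commutator \<sigma> \<rho>"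
proof -
  have "centralizes \<rho> \<sigma> \<delta> \<longleftrightarrow> centralizes \<sigma> \<rho> \<delta>" if "congruence \<delta>" for \<delta>
    using centralizes_iff_sandwich_condition[OF assms(1) _ that]
      sandwich_condition_commute[OF assms(1) _ _ that] assms(2,3)
    by blast
  then have "{\<delta>. congruence \<delta> \<and> centralizes \<rho> \<sigma> \<delta>} = {\<delta>. congruence \<delta> \<and> centralizes \<sigma> \<rho> \<delta>}"
    by blast
  then show ?thesis
    by (simp add: commutator_eq_Inter)
qed

end
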